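(* Every simple order type with at most $2$ interior points is inscribable. That is, if $P\subset\mathbb{R}^2$ is a finite point set with no three collinear points and with at most $2$ interior points, then there is a finite point set $Q\subset\mathbb{R}^2$ with the same order type as $P$ such that all extreme points of $Q$ lie on a common circle.
   Context: The orientation of an ordered triple of points in the plane is positive if they appear in counterclockwise order around their convex hull, negative if clockwise, and zero if they are collinear. Two finite point sets (configurations) $P,Q\subset\mathbb{R}^2$ have the same order type if there is a bijection between them preserving the orientation of every ordered triple. An order type is an equivalence class of this relation, and an element of the class is said to realize the order type. An order type is simple if it has no collinear triples. The extreme points of a configuration $P$ are the vertices of its convex hull, and the other points of $P$ are its interior points. A configuration is inscribed if all its extreme points lie on a circle. A configuration (or its order type) is inscribable if it has the same order type as some inscribed configuration. *)

theory Defs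
  imports "HOL-Analysis.Analysis"
begin

text \<open>
  The orientation of an ordered triple, encoded as an element of \<open>{-1, 0, 1}\<close>: the determinant is
  twice the signed area of the triangle \<open>p q r\<close>, so its sign is \<open>1\<close> for a counterclockwise triple,
  \<open>-1\<close> for a clockwise one, and \<open>0\<close> for a collinear one (in particular if two points coincide).
\<close>
definition orientation :: "real^2 \<Rightarrow> real^2 \<Rightarrow> real^2 \<Rightarrow> real" where
  "orientation p q r = sgn (det (vector [q - p, r - p] :: real^2^2))"

lemma orientation_eq_0_iff_collinear: "orientation p q r = 0 \<longleftrightarrow> collinear {p, q, r}"
proof -
  have "collinear {p, q, r} \<longleftrightarrow> collinear {0, p - q, r - q}"
    by (rule collinear_3) (simp add: NO_MATCH_def)
  also have "\<dots> \<longleftrightarrow> \<bar>(p - q) \<bullet> (r - q)\<bar> = \<bar>norm (p - q) * norm (r - q)\<bar>"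
    by (simp add: norm_cauchy_schwarz_equal)
  also have "\<dots> \<longleftrightarrow> ((p - q) \<bullet> (r - q))\<^sup>2 = ((p - q) \<bullet> (p - q)) * ((r - q) \<bullet> (r - q))"
    by (simp only: abs_eq_iff power2_eq_iff[symmetric] power_mult_distrib power2_norm_eq_inner)
  also have "\<dots> \<longleftrightarrow> (det (vector [q - p, r - p] :: real^2^2))\<^sup>2 = 0"
  proof -
    have "((p - q) \<bullet> (p - q)) * ((r - q) \<bullet> (r - q)) - ((p - q) \<bullet> (r - q))\<^sup>2
        = (det (vector [q - p, r - p] :: real^2^2))\<^sup>2"
      unfolding inner_vec_def sum_2 det_2 vector_2 vector_minus_component inner_real_def
      by algebra
    then show ?thesis
      by linarith
  qed
  finally show ?thesis
    by (simp add: orientation_def sgn_zero_iff)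
qed

definition same_order_type :: "(real^2) set \<Rightarrow> (real^2) set \<Rightarrow> bool" where
  "same_order_type P Q \<longleftrightarrow>
     (\<exists>f. bij_betw f P Q \<and>
       (\<forall>p\<in>P. \<forall>q\<in>P. \<forall>r\<in>P. orientation (f p) (f q) (f r) = orientation p q r))"

definition simple_configuration :: "(real^2) set \<Rightarrow> bool" where
  "simple_configuration P \<longleftrightarrow>
     (\<forall>p\<in>P. \<forall>q\<in>P. \<forall>r\<in>P. p \<noteq> q \<and> q \<noteq> r \<and> p \<noteq> r \<longrightarrow> \<not> collinear {p, q, r})"

definition extreme_points :: "(real^2) set \<Rightarrow> (real^2) set" where
  "extreme_points P = {x. x extreme_point_of (convex hull P)}"

text \<open>Not the topological interior: a point of \<open>P\<close> on an edge of the hull would count as well.\<close>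
definition interior_points :: "(real^2) set \<Rightarrow> (real^2) set" where
  "interior_points P = P - extreme_points P"

definition inscribed :: "(real^2) set \<Rightarrow> bool" where
  "inscribed P \<longleftrightarrow> (\<exists>c \<rho>. \<rho> > 0 \<and> extreme_points P \<subseteq> sphere c \<rho>)"

definition inscribable :: "(real^2) set \<Rightarrow> bool" where
  "inscribable P \<longleftrightarrow> (\<exists>Q. finite Q \<and> same_order_type P Q \<and> inscribed Q)"

end

theory Submission
  imports Defs
begin

text \<open>
  Seen from a point \<open>q\<close> of a convex set, the orientations of \<open>q\<close> with pairs of extreme points
  determine the orientations of all triples of extreme points. So with one interior point \<open>q\<close> it
  suffices to project the extreme points radially from \<open>q\<close> to a circle around \<open>q\<close>; without
  interior points a generic point of the hull plays the role of \<open>q\<close>.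

  With two interior points \<open>q, r\<close>, the line \<open>q r\<close> splits the extreme points into upper and lower
  ones, and the only further information is, for each upper \<open>a\<close> and lower \<open>b\<close>, where the segment
  \<open>a b\<close> crosses the line: before \<open>q\<close>, between \<open>q\<close> and \<open>r\<close>, or after \<open>r\<close>. On the unit circle,
  with suitable real coordinates \<open>t\<close> on the two half circles, these three cases become
  \<open>t b < t a\<close>, \<open>t a < t b < t a + 1\<close> and \<open>t a + 1 < t b\<close>. Numbers \<open>t\<close> with the prescribed
  comparisons are found greedily from left to right, much as proper interval orders are shown to be
  unit interval orders.
\<close>

section \<open>Orientations and triangles\<close>

definition signed_area :: "real^2 \<Rightarrow> real^2 \<Rightarrow> real^2 \<Rightarrow> real" where
  "signed_area p q r = (q$1 - p$1) * (r$2 - p$2) - (q$2 - p$2) * (r$1 - p$1)"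

lemma orientation_signed_area: "orientation p q r = sgn (signed_area p q r)"
  by (simp add: orientation_def signed_area_def det_2)

lemma signed_area_rotate: "signed_area q r p = signed_area p q r"
  by (simp add: signed_area_def algebra_simps)

lemma signed_area_swap: "signed_area q p r = - signed_area p q r"
  by (simp add: signed_area_def algebra_simps)

lemma signed_area_eq [simp]: "signed_area p p r = 0" "signed_area p r r = 0" "signed_area p r p = 0"
  by (simp_all add: signed_area_def algebra_simps)

lemma signed_area_split:
  "signed_area a b c = signed_area q a b + signed_area q b c + signed_area q c a"
  by (simp add: signed_area_def algebra_simps)

lemma orientation_rotate: "orientation q r p = orientation p q r"
  by (simp add: orientation_signed_area signed_area_rotate)

lemma orientation_swap: "orientation q p r = - orientation p q r"
  by (simp add: orientation_signed_area signed_area_swap[of q p] sgn_minus)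

lemma orientation_swap_right: "orientation p r q = - orientation p q r"
  using orientation_swap[of p r q] orientation_rotate[of p q r] orientation_rotate[of r p q] by simp

lemma orientation_degenerate [simp]:
  "orientation p p r = 0" "orientation p r r = 0" "orientation p r p = 0"
  by (simp_all add: orientation_signed_area)

text \<open>The ratios of the three areas to that of \<open>a b c\<close> are the barycentric
  coordinates of \<open>x\<close> (Cramer's rule).\<close>

lemma in_triangleI:
  assumes "signed_area x b c \<ge> 0" "signed_area a x c \<ge> 0" "signed_area a b x \<ge> 0"
    and pos: "signed_area a b c > 0"
  shows "x \<in> convex hull {a, b, c}"
proof -
  let ?d = "signed_area a b c"
  let ?u = "signed_area x b c / ?d" and ?v = "signed_area a x c / ?d" and ?w = "signed_area a b x / ?d"
  have "?u + ?v + ?w = (signed_area x b c + signed_area a x c + signed_area a b x) / ?d"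
    by (simp add: add_divide_distrib)
  also have "signed_area x b c + signed_area a x c + signed_area a b x = ?d"
    by (simp add: signed_area_def algebra_simps)
  finally have sum: "?u + ?v + ?w = 1"
    using pos by simp
  have "?d * x$i = signed_area x b c * a$i + signed_area a x c * b$i + signed_area a b x * c$i" for i
    using exhaust_2[of i] by (auto simp: signed_area_def algebra_simps)
  then have "x$i = (?u *\<^sub>R a + ?v *\<^sub>R b + ?w *\<^sub>R c) $ i" for i
    using pos by (simp add: field_simps)
  then have "x = ?u *\<^sub>R a + ?v *\<^sub>R b + ?w *\<^sub>R c"
    by (simp add: vec_eq_iff)
  moreover have "?u \<ge> 0" "?v \<ge> 0" "?w \<ge> 0"
    using assms by simp_all
  ultimately show ?thesis
    using sum unfolding convex_hull_3 by blast
qed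

lemma extreme_point_of_in: "x extreme_point_of K \<Longrightarrow> x \<in> K"
  by (simp add: extreme_point_of_def)

text \<open>Removing an extreme point from a convex set leaves a convex set, which contains the hull
  of any other points of \<open>K\<close>.\<close>

lemma extreme_point_of_not_in_hull:
  assumes "convex K" "x extreme_point_of K" "S \<subseteq> K" "x \<in> convex hull S"
  shows "x \<in> S"
proof (rule ccontr)
  assume "x \<notin> S"
  then have "convex hull S \<subseteq> K - {x}"
    using assms extreme_point_of_stillconvex by (intro hull_minimal) auto
  then show False
    using assms by auto
qed

text \<open>The point \<open>b\<close> seen from \<open>q\<close> in the cone spanned by \<open>a\<close> and \<open>c\<close> must lie beyond the
  line \<open>a c\<close>, since otherwise it would be in the triangle \<open>q a c\<close>.\<close>

lemma signed_area_pos_of_cone: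
  assumes K: "convex K" "q \<in> K" "a extreme_point_of K" "b extreme_point_of K" "c extreme_point_of K"
    and pos: "signed_area q a b > 0" "signed_area q b c > 0" "signed_area q a c > 0"
  shows "signed_area a b c > 0"
proof (rule ccontr)
  assume "\<not> signed_area a b c > 0"
  then have "signed_area b a c \<ge> 0"
    by (simp add: signed_area_swap[of b a])
  then have "b \<in> convex hull {q, a, c}"
    using pos by (intro in_triangleI) auto
  then have "b \<in> {q, a, c}"
    using K by - (rule extreme_point_of_not_in_hull[of K], (auto dest: extreme_point_of_in)+)
  then show False
    using pos by auto
qed

text \<open>The area of \<open>a b c\<close> is the sum of the three areas seen from
  \<open>q\<close>. If their signs agree, this settles it; otherwise two agree, and by
  \<open>signed_area_pos_of_cone\<close> these two outweigh the third.\<close>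

lemma orientation_extreme_points:
  assumes K: "convex K" "q \<in> K" "a extreme_point_of K" "b extreme_point_of K" "c extreme_point_of K"
    and ne: "orientation q a b \<noteq> 0" "orientation q b c \<noteq> 0" "orientation q c a \<noteq> 0"
  shows "orientation a b c = sgn (orientation q a b + orientation q b c + orientation q c a)"
proof -
  define u v w where uvw: "u = signed_area q a b" "v = signed_area q b c" "w = signed_area q c a"
  have sum: "signed_area a b c = u + v + w"
    unfolding uvw by (rule signed_area_split)
  have rev: "signed_area q b a = -u" "signed_area q c b = -v" "signed_area q a c = -w"
    "signed_area b c a = u + v + w" "signed_area c a b = u + v + w"
    "signed_area c b a = - (u + v + w)" "signed_area b a c = - (u + v + w)" "signed_area a c b = - (u + v + w)"
    using sum by (auto simp: uvw signed_area_def algebra_simps)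
  note cone = signed_area_pos_of_cone[OF K(1,2)]
  have "u \<noteq> 0" "v \<noteq> 0" "w \<noteq> 0"
    using ne by (auto simp: uvw orientation_signed_area sgn_zero_iff)
  moreover have "u > 0 \<Longrightarrow> v > 0 \<Longrightarrow> w < 0 \<Longrightarrow> u + v + w > 0"
    using cone[of a b c] K rev sum uvw by simp
  moreover have "v > 0 \<Longrightarrow> w > 0 \<Longrightarrow> u < 0 \<Longrightarrow> u + v + w > 0"
    using cone[of b c a] K rev sum uvw by simp
  moreover have "w > 0 \<Longrightarrow> u > 0 \<Longrightarrow> v < 0 \<Longrightarrow> u + v + w > 0"
    using cone[of c a b] K rev sum uvw by simp
  \<comment> \<open>When two signs are negative, the triple is read backwards.\<close>
  moreover have "u < 0 \<Longrightarrow> v < 0 \<Longrightarrow> w > 0 \<Longrightarrow> u + v + w < 0"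
    using cone[of c b a] K rev sum uvw by simp
  moreover have "v < 0 \<Longrightarrow> w < 0 \<Longrightarrow> u > 0 \<Longrightarrow> u + v + w < 0"
    using cone[of a c b] K rev sum uvw by simp
  moreover have "w < 0 \<Longrightarrow> u < 0 \<Longrightarrow> v > 0 \<Longrightarrow> u + v + w < 0"
    using cone[of b a c] K rev sum uvw by simp
  ultimately show ?thesis
    unfolding orientation_signed_area sum uvw(1-3)[symmetric]
    by (cases "u > 0"; cases "v > 0"; cases "w > 0") (auto simp: sgn_if)
qed

text \<open>A line through two extreme points on the same side of the line \<open>q r\<close> does not separate
  \<open>q\<close> from \<open>r\<close>.\<close>

lemma not_separated_by_extreme_points:
  assumes K: "convex K" "q \<in> K" "r \<in> K" "a extreme_point_of K" "b extreme_point_of K"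
    and side: "signed_area q r a * signed_area q r b > 0"
    and pos: "signed_area q a b > 0"
  shows "signed_area r a b \<ge> 0"
proof (rule ccontr)
  assume neg: "\<not> signed_area r a b \<ge> 0"
  show False
  \<comment> \<open>If the line \<open>a b\<close> separated \<open>q\<close> from \<open>r\<close>,
    one of \<open>a\<close>, \<open>b\<close> would lie in the triangle formed by \<open>q\<close>,
    \<open>r\<close> and the other. Which one depends on the side of the line
    \<open>q r\<close>.\<close>
  proof (cases "signed_area q r a > 0")
    case True
    have "signed_area q r b = signed_area a r b + signed_area q a b + signed_area q r a"
      by (simp add: signed_area_def algebra_simps)
    moreover have "signed_area a r b > 0"
      using neg by (simp add: signed_area_swap[of a r])
    ultimately have "a \<in> convex hull {q, r, b}"
      using True pos by (intro in_triangleI) auto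
    then have "a \<in> {q, r, b}"
      using K by - (rule extreme_point_of_not_in_hull[of K], (auto dest: extreme_point_of_in)+)
    then show False
      using pos neg True by auto
  next
    case False
    then have *: "signed_area r q b > 0"
      using side by (auto simp: zero_less_mult_iff signed_area_swap[of r q])
    have "signed_area r q a = signed_area b q a + signed_area r b a + signed_area r q b"
      "signed_area b q a = signed_area q a b" "signed_area r b a = - signed_area r a b"
      by (auto simp: signed_area_def algebra_simps)
    then have "b \<in> convex hull {r, q, a}"
      using * pos neg by (intro in_triangleI) auto
    then have "b \<in> {r, q, a}"
      using K by - (rule extreme_point_of_not_in_hull[of K], (auto dest: extreme_point_of_in)+)
    then show False
      using pos neg * by auto
  qed
qed

section \<open>Orientation-preserving maps\<close>

lemma simple_configurationD:
  assumes "simple_configuration P" "p \<in> P" "q \<in> P" "r \<in> P" "p \<noteq> q" "q \<noteq> r" "p \<noteq> r"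
  shows "orientation p q r \<noteq> 0"
  using assms by (auto simp: simple_configuration_def orientation_eq_0_iff_collinear)

lemma extreme_points_subset: "extreme_points P \<subseteq> P"
  using extreme_point_of_convex_hull by (auto simp: extreme_points_def)

text \<open>Caratheodory puts \<open>q\<close> into a triangle of other points, and general position
  makes its barycentric coordinates nonzero. The conclusion speaks of orientations only, so it
  transfers along orientation-preserving maps.\<close>

lemma interior_points_in_triangle:
  assumes fin: "finite P" and simple: "simple_configuration P" and q: "q \<in> interior_points P"
  obtains a b c where "a \<in> P" "b \<in> P" "c \<in> P" "a \<noteq> q" "b \<noteq> q" "c \<noteq> q"
    "orientation q b c = 1" "orientation a q c = 1" "orientation a b q = 1" "orientation a b c = 1"
proof -
  have qP: "q \<in> P" and "\<not> q extreme_point_of (convex hull P)"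
    using q by (auto simp: interior_points_def extreme_points_def)
  then have "q \<in> convex hull (P - {q})"
    using extreme_point_of_convex_hull_insert[of "P - {q}" q] fin by (auto simp: insert_absorb)
  then obtain S where S: "finite S" "S \<subseteq> P - {q}" "card S \<le> 3" "q \<in> convex hull S"
    unfolding caratheodory[of "P - {q}"] by auto
  have "card S = 3"
  proof (rule ccontr)
    assume "card S \<noteq> 3"
    then have "card S = 0 \<or> card S = 1 \<or> card S = 2"
      using S(3) by auto
    then consider "S = {}" | a where "S = {a}" | a b where "S = {a, b}" "a \<noteq> b"
      using S(1) by (auto simp: card_1_singleton_iff card_2_iff)
    then show False
    proof cases
      case 3
      then have "q \<in> closed_segment a b"
        using S(4) by (simp add: segment_convex_hull)
      then have "orientation q a b = 0"
        unfolding orientation_eq_0_iff_collinear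
        by (metis between_imp_collinear between_mem_segment insert_commute)
      then show False
        using simple_configurationD[OF simple qP, of a b] 3 S(2) by auto
    qed (use S in auto)
  qed
  then obtain a b c where abc: "S = {a, b, c}" "a \<noteq> b" "a \<noteq> c" "b \<noteq> c"
    by (auto simp: card_3_iff)
  then obtain u v w where uvw: "u \<ge> 0" "v \<ge> 0" "w \<ge> 0" "u + v + w = 1"
      and qe: "q = u *\<^sub>R a + v *\<^sub>R b + w *\<^sub>R c"
    using S(4) by (auto simp: convex_hull_3)
  have u: "u = 1 - v - w" using uvw by simp
  have in_P: "a \<in> P" "b \<in> P" "c \<in> P" "a \<noteq> q" "b \<noteq> q" "c \<noteq> q"
    using S abc by auto
  have eqs: "signed_area q b c = u * signed_area a b c" "signed_area a q c = v * signed_area a b c"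
    "signed_area a b q = w * signed_area a b c"
    unfolding qe signed_area_def u by (simp_all, algebra+)
  have ne: "orientation q b c \<noteq> 0" "orientation a q c \<noteq> 0" "orientation a b q \<noteq> 0"
    using simple_configurationD[OF simple, of q b c] simple_configurationD[OF simple, of a q c]
      simple_configurationD[OF simple, of a b q] in_P abc qP by auto
  then have "u \<noteq> 0" "v \<noteq> 0" "w \<noteq> 0" and d: "signed_area a b c \<noteq> 0"
    by (auto simp: orientation_signed_area eqs)
  then have pos: "u > 0" "v > 0" "w > 0"
    using uvw by auto
  show thesis
  proof (cases "signed_area a b c > 0")
    case True
    then show thesis
      using pos in_P by (intro that[of a b c]) (auto simp: orientation_signed_area eqs)
  next
    case False
    then have "signed_area b a c > 0"
      using d by (simp add: signed_area_swap[of b a])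
    moreover have "signed_area q a c = v * signed_area b a c" "signed_area b q c = u * signed_area b a c"
      "signed_area b a q = w * signed_area b a c"
      using eqs signed_area_swap[of q a c] signed_area_swap[of b q c] signed_area_swap[of b a q]
        signed_area_swap[of b a c] by simp_all
    ultimately show thesis
      using pos in_P by (intro that[of b a c]) (auto simp: orientation_signed_area)
  qed
qed

text \<open>Images of interior points may be anywhere: lying in a triangle is a matter of
  orientations, so these images are again not extreme. Injectivity holds because two points with
  equal images would form a degenerate image triple with a third point.\<close>

lemma inscribableI:
  assumes fin: "finite P" and simple: "simple_configuration P" and card: "card P \<ge> 3"
    and f: "\<And>p q r. p \<in> P \<Longrightarrow> q \<in> P \<Longrightarrow> r \<in> P \<Longrightarrow> p \<noteq> q \<Longrightarrow> q \<noteq> r \<Longrightarrow> p \<noteq> r \<Longrightarrow>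
           orientation (f p) (f q) (f r) = orientation p q r"
    and circle: "\<And>p. p \<in> extreme_points P \<Longrightarrow> f p \<in> sphere 0 1"
  shows "inscribable P"
proof -
  have f': "orientation (f p) (f q) (f r) = orientation p q r" if "p \<in> P" "q \<in> P" "r \<in> P" for p q r
    using f[OF that] by (cases "p = q \<or> q = r \<or> p = r") auto
  have "inj_on f P"
  proof (rule inj_onI, rule ccontr)
    fix p q assume pq: "p \<in> P" "q \<in> P" "f p = f q" "p \<noteq> q"
    have "\<not> P \<subseteq> {p, q}"
      using card card_mono[of "{p, q}" P] pq by auto
    then obtain r where "r \<in> P" "r \<noteq> p" "r \<noteq> q"
      by auto
    then show False
      using f'[of p q r] simple_configurationD[OF simple, of p q r] pq by auto
  qed
  then have "same_order_type P (f ` P)"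
    unfolding same_order_type_def using f' by (blast intro: inj_on_imp_bij_betw)
  moreover have "inscribed (f ` P)"
  proof -
    have "f p \<in> sphere 0 1" if p: "p \<in> P" "f p extreme_point_of (convex hull (f ` P))" for p
    proof (rule ccontr)
      assume "f p \<notin> sphere 0 1"
      then have "p \<in> interior_points P"
        using circle p by (auto simp: interior_points_def)
      then obtain a b c where abc: "a \<in> P" "b \<in> P" "c \<in> P" "a \<noteq> p" "b \<noteq> p" "c \<noteq> p"
        and pos: "orientation p b c = 1" "orientation a p c = 1" "orientation a b p = 1"
          "orientation a b c = 1"
        using interior_points_in_triangle[OF fin simple] by metis
      have "f p \<in> convex hull {f a, f b, f c}"
        using pos abc p f'[of p b c] f'[of a p c] f'[of a b p] f'[of a b c]
        by (intro in_triangleI) (auto simp: orientation_signed_area sgn_1_pos)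
      then have "f p \<in> {f a, f b, f c}"
        using abc p by - (rule extreme_point_of_not_in_hull[of "convex hull (f ` P)"], (auto simp: hull_inc)+)
      then show False
        using \<open>inj_on f P\<close> abc p by (auto simp: inj_on_eq_iff)
    qed
    then have "extreme_points (f ` P) \<subseteq> sphere 0 1"
      using extreme_points_subset[of "f ` P"] by (auto simp: extreme_points_def)
    then show ?thesis
      unfolding inscribed_def using zero_less_one by blast
  qed
  ultimately show ?thesis
    unfolding inscribable_def using fin by blast
qed


section \<open>At most one interior point\<close>

text \<open>The tangent hyperplane at \<open>x\<close> supports the ball and touches it only at
  \<open>x\<close>.\<close>

lemma extreme_point_of_cball: "x \<in> sphere 0 1 \<Longrightarrow> x extreme_point_of cball 0 1"
  for x :: "'a::euclidean_space"
proof (rule extreme_point_of_Int_supporting_hyperplane_le[where a = x and b = 1])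
  assume x: "x \<in> sphere 0 1"
  then show "x \<bullet> y \<le> 1" if "y \<in> cball 0 1" for y
    using that norm_cauchy_schwarz[of x y] by auto
  have "y = x" if "norm y \<le> 1" "x \<bullet> y = 1" for y
  proof -
    have "(norm (y - x))\<^sup>2 = (norm y)\<^sup>2 - 2 * (x \<bullet> y) + (norm x)\<^sup>2"
      by (simp add: power2_norm_eq_inner algebra_simps inner_commute)
    also have "\<dots> \<le> 0"
      using that x by (simp add: power_le_one)
    finally show ?thesis by simp
  qed
  moreover have "x \<bullet> x = 1"
    using x by (simp add: norm_eq_1)
  ultimately show "cball 0 1 \<inter> {y. x \<bullet> y = 1} = {x}"
    using x by auto
qed

text \<open>Apply \<open>orientation_extreme_points\<close> twice, in the hull of \<open>P\<close>
  and in the unit disc. Points of the circle are extreme in the disc, so the hull of the image need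
  not be studied.\<close>

lemma orientation_on_circle:
  assumes q: "q \<in> convex hull P"
    and ne: "\<And>x y. x \<in> extreme_points P \<Longrightarrow> y \<in> extreme_points P \<Longrightarrow> x \<noteq> y \<Longrightarrow> orientation q x y \<noteq> 0"
    and f: "f ` extreme_points P \<subseteq> sphere 0 1" "q' \<in> cball 0 1"
      "\<And>x y. x \<in> extreme_points P \<Longrightarrow> y \<in> extreme_points P \<Longrightarrow> x \<noteq> y \<Longrightarrow>
        orientation q' (f x) (f y) = orientation q x y"
    and abc: "{a, b, c} \<subseteq> extreme_points P" "a \<noteq> b" "b \<noteq> c" "a \<noteq> c"
  shows "orientation (f a) (f b) (f c) = orientation a b c"
proof -
  have ne': "orientation q a b \<noteq> 0" "orientation q b c \<noteq> 0" "orientation q c a \<noteq> 0"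
    using ne abc by auto
  have "orientation a b c = sgn (orientation q a b + orientation q b c + orientation q c a)"
    using abc ne' by (intro orientation_extreme_points[OF convex_convex_hull q])
      (auto simp: extreme_points_def)
  moreover have "orientation (f a) (f b) (f c) =
    sgn (orientation q' (f a) (f b) + orientation q' (f b) (f c) + orientation q' (f c) (f a))"
    using f(1) abc ne' by (intro orientation_extreme_points[OF convex_cball f(2)] extreme_point_of_cball)
      (auto simp: f(3))
  ultimately show ?thesis
    using abc by (simp add: f(3))
qed

text \<open>On vectors \<open>sgn\<close> is normalization, which multiplies the area by a positive
  factor.\<close>

lemma orientation_radial:
  "orientation 0 (sgn (x - q)) (sgn (y - q)) = orientation q x y"
proof (cases "x = q \<or> y = q")
  case True
  then show ?thesis by auto
next
  case False
  have "signed_area 0 (sgn (x - q)) (sgn (y - q)) =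
      inverse (norm (x - q)) * inverse (norm (y - q)) * signed_area q x y"
    by (simp add: signed_area_def sgn_div_norm algebra_simps)
  then show ?thesis
    using False by (simp add: orientation_signed_area sgn_mult)
qed

text \<open>Here \<open>q\<close> stands for the only interior point, or for an auxiliary point when
  there is none.\<close>

lemma inscribable_radial:
  assumes fin: "finite P" and simple: "simple_configuration P" and card: "card P \<ge> 3"
    and q: "q \<in> convex hull P" "interior_points P \<subseteq> {q}"
    and ne: "\<And>x y. x \<in> extreme_points P \<Longrightarrow> y \<in> extreme_points P \<Longrightarrow> x \<noteq> y \<Longrightarrow> orientation q x y \<noteq> 0"
  shows "inscribable P"
proof (rule inscribableI[OF fin simple card])
  define f where "f x = sgn (x - q)" for x
  have fq: "f q = 0"
    by (simp add: f_def)
  have q_or: "orientation (f q) (f x) (f y) = orientation q x y" for x y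
    unfolding fq unfolding f_def by (rule orientation_radial)
  \<comment> \<open>Since \<open>sgn 0 = 0\<close> is off the circle, \<open>q\<close> must not be
    extreme. If it were, a second point \<open>y\<close> would violate \<open>ne\<close>, as
    \<open>orientation q q y = 0\<close>.\<close>
  have "x \<noteq> q" if x: "x \<in> extreme_points P" for x
  proof
    assume "x = q"
    have "\<not> P \<subseteq> {q}"
      using card card_mono[of "{q}" P] by auto
    then obtain y where y: "y \<in> P" "y \<noteq> q" by auto
    then have "y \<in> extreme_points P"
      using q by (auto simp: interior_points_def)
    then show False
      using ne[of x y] x y \<open>x = q\<close> by auto
  qed
  then show circle: "f p \<in> sphere 0 1" if "p \<in> extreme_points P" for p
    using that by (auto simp: f_def norm_sgn)
  have P: "p \<in> extreme_points P \<or> p = q" if "p \<in> P" for p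
    using that q by (auto simp: interior_points_def)
  fix a b c assume abc: "a \<in> P" "b \<in> P" "c \<in> P" "a \<noteq> b" "b \<noteq> c" "a \<noteq> c"
  consider "a = q" | "b = q" | "c = q" | "{a, b, c} \<subseteq> extreme_points P"
    using P abc by blast
  then show "orientation (f a) (f b) (f c) = orientation a b c"
  proof cases
    case 1 then show ?thesis using q_or by simp
  next
    case 2 then show ?thesis
      using q_or[of c a] orientation_rotate[of q c a] orientation_rotate[of "f q" "f c" "f a"]
      by (simp add: orientation_rotate)
  next
    case 3 then show ?thesis
      using q_or[of a b] orientation_rotate[of a b q] orientation_rotate[of "f a" "f b" "f q"]
      by simp
  next
    case 4
    show ?thesis
    proof (rule orientation_on_circle[OF q(1) ne, where q' = "f q"])
      show "f ` extreme_points P \<subseteq> sphere 0 1"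
        using circle by blast
    qed (use fq q_or abc 4 in simp_all)
  qed
qed

text \<open>The points to avoid form finitely many lines, a null set, which cannot cover a nonempty
  open set.\<close>

lemma exists_generic_point:
  assumes "finite E" "open U" "U \<noteq> {}"
  obtains q where "q \<in> U" "\<And>x y. x \<in> E \<Longrightarrow> y \<in> E \<Longrightarrow> x \<noteq> y \<Longrightarrow> orientation q x y \<noteq> 0"
proof -
  have "negligible {q. orientation q x y = 0}" if "x \<noteq> y" for x y :: "real^2"
  proof -
    define a :: "real^2" where "a = vector [x$2 - y$2, y$1 - x$1]"
    have "a \<noteq> 0"
      using that by (auto simp: a_def vec_eq_iff forall_2)
    moreover have "{q. orientation q x y = 0} = {q. a \<bullet> q = x$2 * y$1 - x$1 * y$2}"
      by (auto simp: a_def orientation_signed_area sgn_zero_iff signed_area_def inner_vec_def sum_2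
          algebra_simps)
    ultimately show ?thesis
      by (simp add: negligible_hyperplane)
  qed
  then have "negligible (\<Union>(x, y)\<in>{(x, y) \<in> E \<times> E. x \<noteq> y}. {q. orientation q x y = 0})"
    using finite_subset[of "{(x, y) \<in> E \<times> E. x \<noteq> y}" "E \<times> E"] \<open>finite E\<close>
    by (intro negligible_Union finite_imageI) auto
  then have "\<not> U \<subseteq> (\<Union>(x, y)\<in>{(x, y) \<in> E \<times> E. x \<noteq> y}. {q. orientation q x y = 0})"
    using open_not_negligible[OF assms(2,3)] negligible_subset by blast
  then obtain q where "q \<in> U" "q \<notin> (\<Union>(x, y)\<in>{(x, y) \<in> E \<times> E. x \<noteq> y}. {q. orientation q x y = 0})"
    by blast
  then show thesis
    by (intro that[of q]) auto
qed

text \<open>A convex set with empty interior lies in a hyperplane, here a line, and then three of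
  the points would be collinear.\<close>

lemma interior_convex_hull_nonempty:
  assumes simple: "simple_configuration P" and card: "card P \<ge> 3"
  shows "interior (convex hull P) \<noteq> {}"
proof
  assume "interior (convex hull P) = {}"
  then obtain a b where a: "a \<noteq> 0" and ab: "convex hull P \<subseteq> {x. a \<bullet> x = b}"
    using empty_interior_subset_hyperplane[OF convex_convex_hull] by blast
  obtain S where "S \<subseteq> P" "card S = 3"
    using obtain_subset_with_card_n[OF card] by metis
  then obtain x y z where xyz: "x \<in> P" "y \<in> P" "z \<in> P" "x \<noteq> y" "x \<noteq> z" "y \<noteq> z"
    by (auto simp: card_3_iff)
  then have "a \<bullet> x = b" "a \<bullet> y = b" "a \<bullet> z = b"
    using ab hull_subset[of P convex] by auto
  then have "a$1 * (y$1 - x$1) + a$2 * (y$2 - x$2) = 0" "a$1 * (z$1 - x$1) + a$2 * (z$2 - x$2) = 0"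
    by (auto simp: inner_vec_def sum_2 algebra_simps)
  then have "a$1 * signed_area x y z = 0" "a$2 * signed_area x y z = 0"
    unfolding signed_area_def by algebra+
  moreover have "signed_area x y z \<noteq> 0"
    using simple_configurationD[OF simple, of x y z] xyz by (auto simp: orientation_signed_area)
  ultimately show False
    using a by (auto simp: vec_eq_iff forall_2)
qed

lemma inscribable_no_interior_point:
  assumes fin: "finite P" and simple: "simple_configuration P" and card: "card P \<ge> 3"
    and "interior_points P = {}"
  shows "inscribable P"
proof -
  obtain q where "q \<in> interior (convex hull P)"
    and "\<And>x y. x \<in> P \<Longrightarrow> y \<in> P \<Longrightarrow> x \<noteq> y \<Longrightarrow> orientation q x y \<noteq> 0"
    using exists_generic_point[OF fin open_interior interior_convex_hull_nonempty[OF simple card]]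
    by blast
  then show ?thesis
    using assms interior_subset extreme_points_subset
    by (intro inscribable_radial[of P q]) blast+
qed

lemma inscribable_one_interior_point:
  assumes fin: "finite P" and simple: "simple_configuration P" and card: "card P \<ge> 3"
    and q: "interior_points P = {q}"
  shows "inscribable P"
proof -
  have qP: "q \<in> P" "q \<notin> extreme_points P"
    using q by (auto simp: interior_points_def)
  then have "orientation q x y \<noteq> 0" if "x \<in> extreme_points P" "y \<in> extreme_points P" "x \<noteq> y" for x y
    using that extreme_points_subset[of P] by (intro simple_configurationD[OF simple]) auto
  then show ?thesis
    using q qP by (intro inscribable_radial[OF fin simple card, of q]) (auto simp: hull_inc)
qed

lemma inscribable_card_le_2:
  assumes fin: "finite P" and card: "card P \<le> 2"
  shows "inscribable P"
proof -
  have "same_order_type P P"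
    unfolding same_order_type_def by (rule exI[of _ id]) auto
  moreover have "inscribed P"
  proof -
    have "card P = 0 \<or> card P = 1 \<or> card P = 2"
      using card by linarith
    then consider a where "P \<subseteq> {a}" | a b where "P = {a, b}" "a \<noteq> b"
      using fin by (auto simp: card_1_singleton_iff card_2_iff)
    then have "\<exists>c \<rho>. \<rho> > 0 \<and> P \<subseteq> sphere c \<rho>"
    proof cases
      case (1 a)
      obtain v :: "real^2" where "norm v = 1"
        using vector_choose_size[of 1] by auto
      then have "P \<subseteq> sphere (a + v) 1"
        using 1 by (auto simp: dist_norm)
      then show ?thesis
        using zero_less_one by blast
    next
      case (2 a b)
      then have "P \<subseteq> sphere (midpoint a b) (dist a b / 2)" "dist a b / 2 > 0"
        by (auto simp: dist_midpoint)
      then show ?thesis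
        by blast
    qed
    then show ?thesis
      unfolding inscribed_def using extreme_points_subset[of P] by blast
  qed
  ultimately show ?thesis
    using fin unfolding inscribable_def by blast
qed

section \<open>Two interior points\<close>

lemma exists_real_between:
  fixes A B :: "real set"
  assumes "finite A" "finite B" "\<And>a b. a \<in> A \<Longrightarrow> b \<in> B \<Longrightarrow> a < b"
  obtains r where "\<And>a. a \<in> A \<Longrightarrow> a < r" "\<And>b. b \<in> B \<Longrightarrow> r < b"
proof -
  consider "A = {}" | "B = {}" | "A \<noteq> {}" "B \<noteq> {}" by blast
  then show thesis
  proof cases
    case 1
    then show thesis
      using assms that[of "Min B - 1"] Min_le[of B] by (metis empty_iff less_diff_eq linorder_not_le
          add_le_cancel_left add.commute diff_less_eq le_less_trans less_add_one)
  next
    case 2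
    then show thesis
      using assms that[of "Max A + 1"] Max_ge[of A] by (meson empty_iff le_less_trans less_add_one)
  next
    case 3
    then have "Max A < Min B"
      using assms by simp
    then obtain r where "Max A < r" "r < Min B"
      using dense by blast
    then show thesis
      using 3 assms that[of r] by simp
  qed
qed

text \<open>The last conjunct, for arbitrary \<open>c\<close>, is what makes the induction work. When the next
  (maximal) element \<open>s\<close> does not satisfy \<open>U\<close>, it has to be put below \<open>t x + 1\<close> for all
  \<open>x\<close> in \<open>U\<close> with \<open>\<beta> s < \<beta> x\<close>; by the case \<open>c = \<beta> s\<close> none of the earlier values blocks this.\<close>

lemma exists_unit_shift_realization:
  fixes \<alpha> \<beta> :: "'a \<Rightarrow> real"
  assumes "finite S"
    and inj: "inj_on \<alpha> S" "inj_on \<beta> S"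
    and mono: "\<And>x y. x \<in> S \<Longrightarrow> y \<in> S \<Longrightarrow> U x = U y \<Longrightarrow> \<alpha> x < \<alpha> y \<Longrightarrow> \<beta> x < \<beta> y"
    and cross: "\<And>x y. x \<in> S \<Longrightarrow> y \<in> S \<Longrightarrow> U x \<Longrightarrow> \<not> U y \<Longrightarrow> \<beta> x < \<beta> y \<Longrightarrow> \<alpha> x < \<alpha> y"
  shows "\<exists>t :: 'a \<Rightarrow> real. (\<forall>x\<in>S. \<forall>y\<in>S. \<alpha> x < \<alpha> y \<longrightarrow> t x < t y)
    \<and> (\<forall>x\<in>S. \<forall>y\<in>S. U x \<and> \<not> U y \<and> \<beta> x < \<beta> y \<longrightarrow> t x + 1 < t y)
    \<and> (\<forall>x\<in>S. \<forall>y\<in>S. U x \<and> \<not> U y \<and> \<beta> y < \<beta> x \<longrightarrow> t y < t x + 1)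
    \<and> ((\<forall>y\<in>S. \<not> U y \<longrightarrow> \<beta> y \<le> c) \<longrightarrow> (\<forall>x\<in>S. U x \<and> c < \<beta> x \<longrightarrow> (\<forall>z\<in>S. t z < t x + 1)))"
  using assms
proof (induction S arbitrary: c rule: finite_ranking_induct[where f = \<alpha>])
  case empty
  then show ?case by auto
next
  case (insert s S)
  show ?case
  proof (cases "s \<in> S")
    case True
    then show ?thesis
      using insert by (simp add: insert_absorb)
  next
    case False
    have max: "\<alpha> x < \<alpha> s" if "x \<in> S" for x
      using insert.hyps(2)[OF that] inj_onD[OF insert.prems(1), of x s] False that by fastforce
    \<comment> \<open>If \<open>U s\<close>, the only upper bounds on the new value come from the
      last conjunct for \<open>c\<close> itself.\<close>
    define c' where "c' = (if U s then c else \<beta> s)"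
    obtain t :: "'a \<Rightarrow> real" where t: "\<And>x y. x \<in> S \<Longrightarrow> y \<in> S \<Longrightarrow> \<alpha> x < \<alpha> y \<Longrightarrow> t x < t y"
      "\<And>x y. x \<in> S \<Longrightarrow> y \<in> S \<Longrightarrow> U x \<Longrightarrow> \<not> U y \<Longrightarrow> \<beta> x < \<beta> y \<Longrightarrow> t x + 1 < t y"
      "\<And>x y. x \<in> S \<Longrightarrow> y \<in> S \<Longrightarrow> U x \<Longrightarrow> \<not> U y \<Longrightarrow> \<beta> y < \<beta> x \<Longrightarrow> t y < t x + 1"
      "\<And>x z. (\<forall>y\<in>S. \<not> U y \<longrightarrow> \<beta> y \<le> c') \<Longrightarrow> x \<in> S \<Longrightarrow> U x \<Longrightarrow> c' < \<beta> x \<Longrightarrow> z \<in> S \<Longrightarrow> t z < t x + 1"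
    proof -
      have *: "inj_on \<alpha> S" "inj_on \<beta> S"
        using insert.prems(1,2) by auto
      have "\<exists>t :: 'a \<Rightarrow> real. (\<forall>x\<in>S. \<forall>y\<in>S. \<alpha> x < \<alpha> y \<longrightarrow> t x < t y)
          \<and> (\<forall>x\<in>S. \<forall>y\<in>S. U x \<and> \<not> U y \<and> \<beta> x < \<beta> y \<longrightarrow> t x + 1 < t y)
          \<and> (\<forall>x\<in>S. \<forall>y\<in>S. U x \<and> \<not> U y \<and> \<beta> y < \<beta> x \<longrightarrow> t y < t x + 1)
          \<and> ((\<forall>y\<in>S. \<not> U y \<longrightarrow> \<beta> y \<le> c') \<longrightarrow> (\<forall>x\<in>S. U x \<and> c' < \<beta> x \<longrightarrow> (\<forall>z\<in>S. t z < t x + 1)))"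
        by (rule insert.IH[OF *]) (use insert.prems(3,4) in \<open>blast+\<close>)
      then obtain t :: "'a \<Rightarrow> real" where "\<forall>x\<in>S. \<forall>y\<in>S. \<alpha> x < \<alpha> y \<longrightarrow> t x < t y"
          "\<forall>x\<in>S. \<forall>y\<in>S. U x \<and> \<not> U y \<and> \<beta> x < \<beta> y \<longrightarrow> t x + 1 < t y"
          "\<forall>x\<in>S. \<forall>y\<in>S. U x \<and> \<not> U y \<and> \<beta> y < \<beta> x \<longrightarrow> t y < t x + 1"
          "(\<forall>y\<in>S. \<not> U y \<longrightarrow> \<beta> y \<le> c') \<longrightarrow> (\<forall>x\<in>S. U x \<and> c' < \<beta> x \<longrightarrow> (\<forall>z\<in>S. t z < t x + 1))"
        by (elim exE conjE)
      then show thesis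
        by (intro that[of t]) simp_all
    qed
    let ?C = "\<forall>y\<in>insert s S. \<not> U y \<longrightarrow> \<beta> y \<le> c"
    \<comment> \<open>Requirements on the value \<open>r\<close> of \<open>s\<close>: above all
      earlier values, because \<open>s\<close> is maximal for \<open>\<alpha>\<close>; on the
      correct side of the shifted upper values; and preserving the last conjunct for
      \<open>c\<close>.\<close>
    let ?extends = "\<lambda>r. (\<forall>x\<in>S. t x < r)
      \<and> (\<not> U s \<longrightarrow> (\<forall>x\<in>S. U x \<longrightarrow> (\<beta> x < \<beta> s \<longrightarrow> t x + 1 < r) \<and> (\<beta> s < \<beta> x \<longrightarrow> r < t x + 1)))
      \<and> (?C \<longrightarrow> (\<forall>x\<in>S. U x \<and> c < \<beta> x \<longrightarrow> r < t x + 1 \<and> (\<forall>z\<in>S. t z < t x + 1)))"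
    have "\<exists>r. ?extends r"
    proof (cases "U s")
      case True
      \<comment> \<open>With \<open>?C\<close> inside the set, \<open>?B\<close> is empty whenever
        the last conjunct claims nothing.\<close>
      let ?B = "{t x + 1 | x. x \<in> S \<and> U x \<and> c < \<beta> x \<and> ?C}"
      have lt: "t z < t x + 1" if ?C "x \<in> S" "U x" "c < \<beta> x" "z \<in> S" for x z
        using t(4) that True by (auto simp: c'_def)
      obtain r where "\<And>a. a \<in> t ` S \<Longrightarrow> a < r" "\<And>b. b \<in> ?B \<Longrightarrow> r < b"
        by (rule exists_real_between[of "t ` S" ?B]) (use insert.hyps(1) lt in auto)
      then show ?thesis
        using lt True by (intro exI[of _ r]) blast
    next
      case False
      let ?A = "t ` S \<union> {t x + 1 | x. x \<in> S \<and> U x \<and> \<beta> x < \<beta> s}"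
      let ?B = "{t x + 1 | x. x \<in> S \<and> U x \<and> \<beta> s < \<beta> x}"
      \<comment> \<open>This is the premise of the last conjunct for \<open>c' = \<beta> s\<close>:
        earlier lower elements have smaller \<open>\<alpha>\<close>, hence smaller
        \<open>\<beta>\<close>.\<close>
      have "\<forall>y\<in>S. \<not> U y \<longrightarrow> \<beta> y \<le> \<beta> s"
        using insert.prems(3)[of _ s] False max by (auto intro: less_imp_le)
      then have lt: "t z < t x + 1" if "x \<in> S" "U x" "\<beta> s < \<beta> x" "z \<in> S" for x z
        using t(4) that False by (auto simp: c'_def)
      \<comment> \<open>Among upper elements \<open>t\<close> also respects \<open>\<beta>\<close>,
        which separates the shifted values in \<open>?A\<close> from those in
        \<open>?B\<close>.\<close>
      have U: "t x < t y" if xy: "x \<in> S" "y \<in> S" "U x" "U y" "\<beta> x < \<beta> y" for x y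
      proof -
        have "\<not> \<alpha> y < \<alpha> x"
          using insert.prems(3)[of y x] xy by auto
        moreover have "\<alpha> y \<noteq> \<alpha> x"
          using insert.prems(1) xy by (auto simp: inj_on_def)
        ultimately show ?thesis
          using t(1) xy by auto
      qed
      obtain r where r: "\<And>a. a \<in> ?A \<Longrightarrow> a < r" "\<And>b. b \<in> ?B \<Longrightarrow> r < b"
      proof (rule exists_real_between[of ?A ?B])
        fix a b assume "a \<in> ?A" "b \<in> ?B"
        then show "a < b"
          using lt U by (auto intro: less_trans)
      qed (use insert.hyps(1) in auto)
      \<comment> \<open>Under \<open>?C\<close> also \<open>\<beta> s \<le> c\<close>, so the bounds
        required for \<open>c\<close> are already among those in \<open>?B\<close>.\<close>
      have "\<beta> s < \<beta> x" if ?C "c < \<beta> x" for x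
        using that False by auto
      then show ?thesis
        using r lt by (intro exI[of _ r]) blast
    qed
    then obtain r where r: "?extends r" ..
    have r1: "t x < r" if "x \<in> S" for x
      using r that by blast
    have r2: "t x + 1 < r" if "\<not> U s" "x \<in> S" "U x" "\<beta> x < \<beta> s" for x
      using r that by blast
    have r3: "r < t x + 1" if "\<not> U s" "x \<in> S" "U x" "\<beta> s < \<beta> x" for x
      using r that by blast
    have r4: "r < t x + 1 \<and> (\<forall>z\<in>S. t z < t x + 1)" if ?C "x \<in> S" "U x" "c < \<beta> x" for x
      using r that by blast
    \<comment> \<open>For a new upper \<open>s\<close>, a lower \<open>y\<close> with
      \<open>\<beta> s < \<beta> y\<close> would have larger \<open>\<alpha>\<close>, against
      maximality; the opposite comparison only asks for \<open>t y < r + 1\<close>.\<close>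
    have no: "\<not> \<beta> s < \<beta> y" if "U s" "y \<in> S" "\<not> U y" for y
      using insert.prems(4)[of s y] max[of y] that by auto
    define t' where "t' = t(s := r)"
    have t': "t' s = r" "\<And>x. x \<in> S \<Longrightarrow> t' x = t x"
      using False by (auto simp: t'_def)
    have "t' x < t' y" if "x \<in> insert s S" "y \<in> insert s S" "\<alpha> x < \<alpha> y" for x y
      using that t(1)[of x y] r1[of x] max[of y] t' by auto
    moreover have "t' x + 1 < t' y"
      if "x \<in> insert s S" "y \<in> insert s S" "U x" "\<not> U y" "\<beta> x < \<beta> y" for x y
      using that t(2)[of x y] r2[of x] no[of y] t' by auto
    moreover have "t' y < t' x + 1"
      if "x \<in> insert s S" "y \<in> insert s S" "U x" "\<not> U y" "\<beta> y < \<beta> x" for x y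
      using that t(3)[of x y] r1[of y] r3[of x] t' by auto
    moreover have "t' z < t' x + 1" if ?C "x \<in> insert s S" "U x" "c < \<beta> x" "z \<in> insert s S" for x z
    proof (cases "x = s")
      case True
      then show ?thesis
        using that r1[of z] t' by fastforce
    next
      case False
      then show ?thesis
        using that(2,5) r4[OF that(1) _ that(3,4)] t' by auto
    qed
    ultimately have "(\<forall>x\<in>insert s S. \<forall>y\<in>insert s S. \<alpha> x < \<alpha> y \<longrightarrow> t' x < t' y)"
      "(\<forall>x\<in>insert s S. \<forall>y\<in>insert s S. U x \<and> \<not> U y \<and> \<beta> x < \<beta> y \<longrightarrow> t' x + 1 < t' y)"
      "(\<forall>x\<in>insert s S. \<forall>y\<in>insert s S. U x \<and> \<not> U y \<and> \<beta> y < \<beta> x \<longrightarrow> t' y < t' x + 1)"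
      "?C \<longrightarrow> (\<forall>x\<in>insert s S. U x \<and> c < \<beta> x \<longrightarrow> (\<forall>z\<in>insert s S. t' z < t' x + 1))"
      by (simp_all del: insert_iff)
    then show ?thesis
      by (intro exI[of _ t'] conjI)
  qed
qed

section \<open>The unit circle parametrised by the tangent of half the angle\<close>

definition circle_point :: "real \<Rightarrow> real^2" where
  "circle_point s = vector [(1 - s\<^sup>2) / (1 + s\<^sup>2), 2 * s / (1 + s\<^sup>2)]"

lemma one_plus_square_pos: "1 + s\<^sup>2 > 0" for s :: real
  by (simp add: add_pos_nonneg)

lemma circle_point_in_sphere: "circle_point s \<in> sphere 0 1"
proof -
  have "circle_point s \<bullet> circle_point s = ((1 - s\<^sup>2)\<^sup>2 + (2 * s)\<^sup>2) / (1 + s\<^sup>2)\<^sup>2"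
    by (simp add: circle_point_def inner_vec_def sum_2 power2_eq_square add_divide_distrib)
  also have "(1 - s\<^sup>2)\<^sup>2 + (2 * s)\<^sup>2 = (1 + s\<^sup>2)\<^sup>2"
    by algebra
  finally show ?thesis
    using one_plus_square_pos[of s] by (simp add: norm_eq_1)
qed

text \<open>Parametrised so that the chord between the parameters \<open>s\<close> and \<open>u\<close> with \<open>s * u < 0\<close> meets the
  horizontal axis at \<open>axis_point (- s * u)\<close>.\<close>

definition axis_point :: "real \<Rightarrow> real^2" where
  "axis_point k = vector [(1 - k) / (1 + k), 0]"

text \<open>For \<open>s \<noteq> u\<close>, the factor \<open>k + s * u\<close> vanishes exactly
  when the chord passes through the axis point; the last factor is positive.\<close>

lemma signed_area_axis_circle:
  assumes "k > 0"
  shows "signed_area (axis_point k) (circle_point s) (circle_point u) =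
    (u - s) * (k + s * u) * (4 / ((1 + k) * (1 + s\<^sup>2) * (1 + u\<^sup>2)))"
proof -
  have "1 + k \<noteq> 0" "1 + s\<^sup>2 \<noteq> 0" "1 + u\<^sup>2 \<noteq> 0"
    using assms one_plus_square_pos[of s] one_plus_square_pos[of u] by auto
  then show ?thesis
    unfolding signed_area_def axis_point_def circle_point_def vector_2
    by (simp add: divide_simps) algebra
qed

lemma orientation_axis_circle:
  assumes "k > 0"
  shows "orientation (axis_point k) (circle_point s) (circle_point u) = sgn (u - s) * sgn (k + s * u)"
proof -
  define c where "c = 4 / ((1 + k) * (1 + s\<^sup>2) * (1 + u\<^sup>2))"
  have "c > 0"
    using assms one_plus_square_pos[of s] one_plus_square_pos[of u] by (simp add: c_def)
  moreover have "signed_area (axis_point k) (circle_point s) (circle_point u) = (u - s) * (k + s * u) * c"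
    unfolding c_def by (rule signed_area_axis_circle[OF assms])
  ultimately show ?thesis
    by (simp add: orientation_signed_area sgn_mult)
qed

text \<open>\<open>axis_point\<close> moves left as its argument grows, so \<open>l\<close> comes
  first; the sign of \<open>s\<close> tells the half circle.\<close>

lemma orientation_axis_axis_circle:
  assumes "0 < k" "k < l"
  shows "orientation (axis_point l) (axis_point k) (circle_point s) = sgn s"
proof -
  define c where "c = 4 * (l - k) / ((1 + k) * (1 + l) * (1 + s\<^sup>2))"
  have "signed_area (axis_point l) (axis_point k) (circle_point s) = s * c"
    using assms one_plus_square_pos[of s]
    unfolding c_def signed_area_def axis_point_def circle_point_def vector_2
    by (simp add: divide_simps) algebra
  moreover have "c > 0"
    using assms one_plus_square_pos[of s] by (simp add: c_def)
  ultimately show ?thesis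
    by (simp add: orientation_signed_area sgn_mult)
qed

text \<open>Logarithmic parameters on the open upper and lower half circles: the chord from \<open>t\<close> on the upper
  to \<open>u\<close> on the lower one meets the axis at \<open>axis_point (exp (t - u))\<close>, hence depends on
  \<open>u - t\<close> only.\<close>

definition circle_param :: "bool \<Rightarrow> real \<Rightarrow> real" where
  "circle_param upper t = (if upper then exp t else - exp (- t))"

lemma sgn_exp_diff: "sgn (exp x - exp y) = sgn (x - y)" for x y :: real
  by (auto simp: sgn_if)

text \<open>Parameters on one half circle have a positive product, so only their difference matters.
  \<open>circle_param\<close> increases with \<open>t\<close> on both halves.\<close>

lemma sgn_circle_param_same:
  assumes "k > 0"
  shows "sgn (circle_param v t' - circle_param v t) * sgn (k + circle_param v t * circle_param v t')
    = sgn (t' - t)"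
proof -
  have "k + circle_param v t * circle_param v t' > 0"
    using assms by (simp add: circle_param_def add_pos_pos)
  moreover have "sgn (circle_param v t' - circle_param v t) = sgn (t' - t)"
    using sgn_exp_diff[of t' t] sgn_exp_diff[of "-t" "-t'"] by (auto simp: circle_param_def)
  ultimately show ?thesis by simp
qed

text \<open>The first factor is always negative; the second compares where the chord meets the axis,
  \<open>exp (t - t')\<close>, with \<open>exp (- a)\<close>.\<close>

lemma sgn_circle_param_opposite:
  "sgn (circle_param False t' - circle_param True t) *
      sgn (exp (- a) + circle_param True t * circle_param False t') = - sgn (t' - t - a)"
proof -
  have "circle_param False t' - circle_param True t < 0"
    by (simp add: circle_param_def) (smt (verit) exp_gt_zero)
  moreover have "circle_param True t * circle_param False t' = - exp (t - t')"
    by (simp add: circle_param_def exp_diff exp_minus field_simps)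
  moreover have "sgn (exp (- a) - exp (t - t')) = sgn (t' - t - a)"
    using sgn_exp_diff[of "-a" "t - t'"] by (simp add: algebra_simps)
  ultimately show ?thesis
    by simp
qed

text \<open>Used with \<open>c = 0\<close> for \<open>q\<close> and \<open>c = 1\<close> for
  \<open>r\<close>, where \<open>g\<close> is a difference of \<open>\<alpha>\<close> or
  \<open>\<beta>\<close> values: the shift \<open>c\<close> enters only between opposite
  halves.\<close>

lemma orientation_axis_circle_param:
  assumes "U = V \<Longrightarrow> sgn (v - u) = sgn g"
    and "U \<Longrightarrow> \<not> V \<Longrightarrow> sgn (v - u - c) = sgn g"
    and "\<not> U \<Longrightarrow> V \<Longrightarrow> sgn (u - v - c) = sgn (- g)"
  shows "orientation (axis_point (exp (- c))) (circle_point (circle_param U u))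
    (circle_point (circle_param V v)) = (if U = V then sgn g else - sgn g)"
proof -
  have "?thesis" if "\<not> U" "V"
  proof -
    have "orientation (axis_point (exp (- c))) (circle_point (circle_param V v))
        (circle_point (circle_param U u)) = sgn g"
      using that sgn_circle_param_opposite[of u v c] assms(3)
      by (simp add: orientation_axis_circle sgn_minus)
    then show ?thesis
      using that orientation_swap_right[of _ "circle_point (circle_param U u)"] by simp
  qed
  then show ?thesis
    using sgn_circle_param_opposite[of v u c] sgn_circle_param_same[of "exp (- c)" V v u] assms(1,2)
    by (cases U; cases V) (simp_all add: orientation_axis_circle)
qed

section \<open>Transferring the views from the two interior points to the circle\<close>

lemma inscribable_two_interior_points:
  assumes fin: "finite P" and simple: "simple_configuration P" and card: "card P \<ge> 3"
    and qr: "interior_points P = {q, r}" "q \<noteq> r"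
  shows "inscribable P"
proof -
  define E where "E = extreme_points P"
  have in_P: "q \<in> P" "r \<in> P" "q \<notin> E" "r \<notin> E" "E \<subseteq> P" "finite E"
    using qr fin extreme_points_subset[of P] by (auto simp: interior_points_def E_def finite_subset)
  have P: "p \<in> E \<or> p = q \<or> p = r" if "p \<in> P" for p
    using that qr by (auto simp: interior_points_def E_def)
  have ext: "p extreme_point_of (convex hull P)" if "p \<in> E" for p
    using that by (simp add: E_def extreme_points_def)
  \<comment> \<open>Coordinates with origin \<open>q\<close> and first axis towards
    \<open>r\<close>, scaled by the length of \<open>r - q\<close>; thus \<open>r\<close> has
    \<open>x = d\<close> and \<open>y = 0\<close>.\<close>
  define x y where "x p = (r - q) \<bullet> (p - q)" and "y p = signed_area q r p" for p
  define d where "d = (r - q) \<bullet> (r - q)"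
  have d: "d > 0"
    using qr by (simp add: d_def)
  have area_q: "signed_area q a b * d = x a * y b - y a * x b" for a b
    by (simp add: signed_area_def x_def y_def d_def inner_vec_def sum_2 algebra_simps)
  have area_r: "signed_area r a b * d = (x a - d) * y b - y a * (x b - d)" for a b
    by (simp add: signed_area_def x_def y_def d_def inner_vec_def sum_2 algebra_simps)
  define U where "U p \<longleftrightarrow> y p > 0" for p
  \<comment> \<open>Minus the cotangents of the angles of \<open>p\<close> as seen from \<open>q\<close> and \<open>r\<close>, relative to the direction
    \<open>r - q\<close>. As cotangents have period \<open>\<pi>\<close>, upper and lower points can be compared directly.\<close>
  define \<alpha> \<beta> where "\<alpha> p = - x p / y p" and "\<beta> p = (d - x p) / y p" for p
  have y: "y p \<noteq> 0" if "p \<in> E" for p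
  proof -
    have "p \<in> P" "p \<noteq> q" "p \<noteq> r"
      using in_P that by auto
    then show ?thesis
      using simple_configurationD[OF simple, of q r p] in_P(1,2) qr(2)
      by (auto simp: y_def orientation_signed_area)
  qed
  have area_q': "signed_area q a b * d = y a * y b * (\<alpha> b - \<alpha> a)" if "a \<in> E" "b \<in> E" for a b
    unfolding area_q \<alpha>_def using y[OF that(1)] y[OF that(2)] by (simp add: field_simps)
  have area_r': "signed_area r a b * d = y a * y b * (\<beta> b - \<beta> a)" if "a \<in> E" "b \<in> E" for a b
    unfolding area_r \<beta>_def using y[OF that(1)] y[OF that(2)] by (simp add: field_simps)
  have sgn_y: "sgn (y a) * sgn (y b) = (if U a = U b then 1 else - 1)" if "a \<in> E" "b \<in> E" for a b
    using y that by (auto simp: U_def sgn_if)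
  have or_q: "orientation q a b = (if U a = U b then sgn (\<alpha> b - \<alpha> a) else - sgn (\<alpha> b - \<alpha> a))"
    if "a \<in> E" "b \<in> E" for a b
    using arg_cong[OF area_q'[OF that], of sgn] sgn_y[OF that] d
    by (auto simp: orientation_signed_area sgn_mult split: if_splits)
  have or_r: "orientation r a b = (if U a = U b then sgn (\<beta> b - \<beta> a) else - sgn (\<beta> b - \<beta> a))"
    if "a \<in> E" "b \<in> E" for a b
    using arg_cong[OF area_r'[OF that], of sgn] sgn_y[OF that] d
    by (auto simp: orientation_signed_area sgn_mult split: if_splits)
  have ne_q: "orientation q a b \<noteq> 0" and ne_r: "orientation r a b \<noteq> 0" if "a \<in> E" "b \<in> E" "a \<noteq> b" for a b
    using simple_configurationD[OF simple, of q a b] simple_configurationD[OF simple, of r a b]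
      that in_P by auto
  have inj: "inj_on \<alpha> E" "inj_on \<beta> E"
  proof -
    show "inj_on \<alpha> E"
    proof (rule inj_onI, rule ccontr)
      fix a b assume "a \<in> E" "b \<in> E" "\<alpha> a = \<alpha> b" "a \<noteq> b"
      then show False using ne_q[of a b] or_q[of a b] by (simp split: if_splits)
    qed
    show "inj_on \<beta> E"
    proof (rule inj_onI, rule ccontr)
      fix a b assume "a \<in> E" "b \<in> E" "\<beta> a = \<beta> b" "a \<noteq> b"
      then show False using ne_r[of a b] or_r[of a b] by (simp split: if_splits)
    qed
  qed
  \<comment> \<open>On one side of the line, extremeness makes the orders seen from \<open>q\<close>
    and from \<open>r\<close> agree.\<close>
  have mono: "\<beta> a < \<beta> b" if ab: "a \<in> E" "b \<in> E" "U a = U b" "\<alpha> a < \<alpha> b" for a b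
  proof -
    have "orientation q a b = 1"
      using or_q ab by simp
    then have "signed_area q a b > 0"
      by (simp add: orientation_signed_area sgn_1_pos)
    moreover have "signed_area q r a * signed_area q r b > 0"
      using y[OF ab(1)] y[OF ab(2)] ab(3)
      unfolding U_def y_def[symmetric] zero_less_mult_iff by linarith
    ultimately have "signed_area r a b \<ge> 0"
      using in_P ab ext[of a] ext[of b]
      by - (rule not_separated_by_extreme_points[of "convex hull P" q r a b], auto simp: hull_inc)
    moreover have "a \<noteq> b"
      using ab by auto
    ultimately have "orientation r a b = 1"
      using ne_r[of a b] ab by (auto simp: orientation_signed_area sgn_if split: if_splits)
    then show ?thesis
      using or_r[of a b] ab by (simp add: sgn_1_pos)
  qed
  \<comment> \<open>The difference \<open>\<beta> - \<alpha>\<close> is \<open>d / y\<close>,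
    positive for upper and negative for lower points.\<close>
  have cross: "\<alpha> a < \<alpha> b" if ab: "a \<in> E" "b \<in> E" "U a" "\<not> U b" "\<beta> a < \<beta> b" for a b
  proof -
    have "\<beta> p = \<alpha> p + d / y p" for p
      by (simp add: \<alpha>_def \<beta>_def diff_divide_distrib)
    moreover have "d / y a > 0" "d / y b < 0"
      using ab d y[of b] by (auto simp: U_def divide_pos_neg)
    ultimately show ?thesis
      using ab(5) by simp
  qed
  obtain t :: "real^2 \<Rightarrow> real" where
    t\<alpha>: "\<And>a b. a \<in> E \<Longrightarrow> b \<in> E \<Longrightarrow> \<alpha> a < \<alpha> b \<Longrightarrow> t a < t b"
    and t\<beta>: "\<And>a b. a \<in> E \<Longrightarrow> b \<in> E \<Longrightarrow> U a \<Longrightarrow> \<not> U b \<Longrightarrow> \<beta> a < \<beta> b \<Longrightarrow> t a + 1 < t b"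
      "\<And>a b. a \<in> E \<Longrightarrow> b \<in> E \<Longrightarrow> U a \<Longrightarrow> \<not> U b \<Longrightarrow> \<beta> b < \<beta> a \<Longrightarrow> t b < t a + 1"
  proof -
    obtain t :: "real^2 \<Rightarrow> real" where "\<forall>x\<in>E. \<forall>y\<in>E. \<alpha> x < \<alpha> y \<longrightarrow> t x < t y"
      "\<forall>x\<in>E. \<forall>y\<in>E. U x \<and> \<not> U y \<and> \<beta> x < \<beta> y \<longrightarrow> t x + 1 < t y"
      "\<forall>x\<in>E. \<forall>y\<in>E. U x \<and> \<not> U y \<and> \<beta> y < \<beta> x \<longrightarrow> t y < t x + 1"
      by (rule exE[OF exists_unit_shift_realization[where U = U and c = 0, OF \<open>finite E\<close> inj]])
        (rule mono, assumption+, rule cross, assumption+, elim conjE)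
    then show thesis
      by (intro that[of t]) simp_all
  qed
  have sgn_\<alpha>: "sgn (t b - t a) = sgn (\<alpha> b - \<alpha> a)" if "a \<in> E" "b \<in> E" for a b
    using t\<alpha>[of a b] t\<alpha>[of b a] inj(1) that
    by (cases "\<alpha> a" "\<alpha> b" rule: linorder_cases) (auto simp: inj_on_eq_iff)
  have sgn_\<beta>: "sgn (t b - t a) = sgn (\<beta> b - \<beta> a)" if "a \<in> E" "b \<in> E" "U a = U b" for a b
    using mono[of a b] mono[of b a] sgn_\<alpha>[of a b] that inj(1)
    by (cases "\<alpha> a" "\<alpha> b" rule: linorder_cases) (auto simp: inj_on_eq_iff)
  have sgn_\<beta>1: "sgn (t b - t a - 1) = sgn (\<beta> b - \<beta> a)" if "a \<in> E" "b \<in> E" "U a" "\<not> U b" for a b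
    using t\<beta>[of a b] inj(2) that
    by (cases "\<beta> a" "\<beta> b" rule: linorder_cases) (auto simp: inj_on_eq_iff)
  define g where "g p = circle_point (circle_param (U p) (t p))" for p
  \<comment> \<open>\<open>q\<close> goes to the centre \<open>axis_point 1\<close> and
    \<open>r\<close> to its right. The form \<open>exp (- 0)\<close> matches
    \<open>orientation_axis_circle_param\<close> with \<open>c = 0\<close>.\<close>
  define f where "f p = (if p = q then axis_point (exp (- 0)) else if p = r then axis_point (exp (- 1)) else g p)"
    for p
  have f_simps: "f q = axis_point (exp (- 0))" "f r = axis_point (exp (- 1))" "p \<in> E \<Longrightarrow> f p = g p" for p
    using qr in_P by (auto simp: f_def)
  have f_q: "orientation (f q) (f a) (f b) = orientation q a b" if "a \<in> E" "b \<in> E" for a b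
    unfolding f_simps(1) f_simps(3)[OF that(1)] f_simps(3)[OF that(2)] g_def or_q[OF that]
    using sgn_\<alpha>[of a b] sgn_\<alpha>[of b a] that by (intro orientation_axis_circle_param) auto
  have f_r: "orientation (f r) (f a) (f b) = orientation r a b" if "a \<in> E" "b \<in> E" for a b
    unfolding f_simps(2) f_simps(3)[OF that(1)] f_simps(3)[OF that(2)] g_def or_r[OF that]
    using sgn_\<beta>[of a b] sgn_\<beta>1[of a b] sgn_\<beta>1[of b a] that
    by (intro orientation_axis_circle_param) auto
  have f_qr: "orientation (f q) (f r) (f a) = orientation q r a" if "a \<in> E" for a
  proof -
    have "orientation (f q) (f r) (f a) = sgn (circle_param (U a) (t a))"
      unfolding f_simps f_simps(3)[OF that] g_def by (intro orientation_axis_axis_circle) auto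
    also have "\<dots> = sgn (y a)"
      using y[OF that] by (auto simp: circle_param_def U_def)
    finally show ?thesis
      by (simp add: y_def orientation_signed_area)
  qed
  have circle: "f p \<in> sphere 0 1" if "p \<in> E" for p
    using circle_point_in_sphere that by (simp add: f_simps g_def)
  have f_E: "orientation (f a) (f b) (f c) = orientation a b c"
    if "a \<in> E" "b \<in> E" "c \<in> E" "a \<noteq> b" "b \<noteq> c" "a \<noteq> c" for a b c
  proof (rule orientation_on_circle[of q P f "f q"])
    show "q \<in> convex hull P"
      using in_P by (simp add: hull_inc)
    show "f ` extreme_points P \<subseteq> sphere 0 1"
      using circle by (auto simp: E_def)
    have "f q = 0"
      by (simp add: f_simps axis_point_def vec_eq_iff forall_2)
    then show "f q \<in> cball 0 1"
      by simp
  qed (use that ne_q f_q in \<open>auto simp: E_def\<close>)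
  show ?thesis
  proof (rule inscribableI[OF fin simple card])
    show "f p \<in> sphere 0 1" if "p \<in> extreme_points P" for p
      using circle that by (simp add: E_def)
    fix a b c assume abc: "a \<in> P" "b \<in> P" "c \<in> P" and ne: "a \<noteq> b" "b \<noteq> c" "a \<noteq> c"
    let ?same = "\<lambda>a b c. orientation (f a) (f b) (f c) = orientation a b c"
    \<comment> \<open>Rotations, and a swap for \<open>r\<close> before \<open>q\<close>, reduce
      each triple to \<open>f_E\<close>, \<open>f_q\<close>, \<open>f_r\<close> or
      \<open>f_qr\<close>.\<close>
    have rot: "?same a b c \<Longrightarrow> ?same b c a" for a b c
      by (simp add: orientation_rotate)
    have swap: "?same a b c \<Longrightarrow> ?same b a c" for a b c
      using orientation_swap[of a b c] orientation_swap[of "f a" "f b" "f c"] by simp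
    show "?same a b c"
      using P[OF abc(1)] P[OF abc(2)] P[OF abc(3)] ne
      by (elim disjE) (blast intro: f_E f_q f_r f_qr rot[OF f_q] rot[OF rot[OF f_q]] rot[OF f_r]
        rot[OF rot[OF f_r]] rot[OF f_qr] rot[OF rot[OF f_qr]] swap[OF f_qr] rot[OF swap[OF f_qr]]
        rot[OF rot[OF swap[OF f_qr]]])+
  qed
qed

theorem theorem1p2:
  fixes P :: "(real^2) set"
  assumes "finite P"
    and "simple_configuration P"
    and "card (interior_points P) \<le> 2"
  shows "inscribable P"
proof (cases "card P \<ge> 3")
  case True
  have "finite (interior_points P)"
    using assms(1) by (simp add: interior_points_def)
  moreover have "card (interior_points P) = 0 \<or> card (interior_points P) = 1 \<or> card (interior_points P) = 2"
    using assms(3) by linarith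
  ultimately consider "interior_points P = {}" | q where "interior_points P = {q}"
    | q r where "interior_points P = {q, r}" "q \<noteq> r"
    by (auto simp: card_1_singleton_iff card_2_iff)
  then show ?thesis
    using assms(1,2) True inscribable_no_interior_point inscribable_one_interior_point
      inscribable_two_interior_points by cases blast+
next
  case False
  then show ?thesis
    using inscribable_card_le_2[OF assms(1)] by linarith
qed

end
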